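(* Let $\mathcal{M}=(M^{ik})_{i,k=1,\dots,5}$ be any solution of the $M$-system with $N=3$ and upper indices $\{1,2,3,4,5\}$, and let $$\mathsf{V}=(M^{\emptyset,\emptyset},M^{45,45},M^{4,4},M^{5,5},M^{5,4},M^{4,5}):\mathbb{Z}^3\to\mathbb{C}^6 .$$ Then, the line complex $\mathsf{l}:\mathbb{Z}^3\to\{\text{lines in }\mathbb{CP}^3\}$ which corresponds to $\mathsf{V}$ via the Plücker correspondence is a fundamental line complex.
   Context: Notation: for a function $f$ on $\mathbb{Z}^3$ the argument is suppressed, and lower indices denote unit shifts: $f=f(n_1,n_2,n_3)$, $f_1=f(n_1+1,n_2,n_3)$, $f_{23}=f(n_1,n_2+1,n_3+1)$, etc. All relations hold at every point of $\mathbb{Z}^3$. $M$-system ($N=3$, upper indices $\{1,2,3,4,5\}$): functions $M^{ik}:\mathbb{Z}^3\to\mathbb{C}$, $i,k\in\{1,\dots,5\}$, with $M^{ll}\neq 0$ for $l\in\{1,2,3\}$, obeying $$M^{ik}_l=M^{ik}-\frac{M^{il}M^{lk}}{M^{ll}},\qquad l\in\{1,2,3\}\setminus\{i,k\}.$$ Minors: for multi-indices $A=(a_1\cdots a_s)$, $B=(b_1\cdots b_s)$, each with distinct entries in $\{1,\dots,5\}$, $M^{A,B}=\det(M^{a_\alpha b_\beta})_{\alpha,\beta=1,\dots,s}$, with $M^{\emptyset,\emptyset}=1$. Thus $\mathsf{V}=(1,\,M^{44}M^{55}-M^{45}M^{54},\,M^{44},\,M^{55},\,M^{54},\,M^{45})$.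 Plücker correspondence: the line in $\mathbb{CP}^3$ through two distinct points with homogeneous coordinates $\mathsf{a}=(\alpha^0,\alpha^1,\alpha^2,\alpha^3)^T$ and $\mathsf{b}=(\beta^0,\beta^1,\beta^2,\beta^3)^T$ is represented by the (projective) vector $(\gamma^{01},\gamma^{23},\gamma^{02},\gamma^{13},\gamma^{03},\gamma^{12})$, where $\gamma^{\mu\nu}=\alpha^\mu\beta^\nu-\alpha^\nu\beta^\mu$. This identifies lines in $\mathbb{CP}^3$ with points of the quadric $\gamma^{01}\gamma^{23}-\gamma^{02}\gamma^{13}+\gamma^{03}\gamma^{12}=0$, on which $\mathsf{V}$ lies. Fundamental line complex in $\mathbb{CP}^3$: a map $\mathsf{l}:\mathbb{Z}^3\to\{\text{lines in }\mathbb{CP}^3\}$ such that any neighbouring lines $\mathsf{l}$ and $\mathsf{l}_l$, $l\in\{1,2,3\}$, intersect and the points of intersection $\mathsf{p}^l=\mathsf{l}\cap\mathsf{l}_l$ enjoy the coplanarity property: for any distinct $l,m,p\in\{1,2,3\}$, the four points $\mathsf{p}^l,\mathsf{p}^l_m,\mathsf{p}^l_{mp},\mathsf{p}^l_p$ are coplanar. (Under genericity assumptions this is equivalent to the concurrency property: for any distinct $l,m,p$, the four lines connecting the points $\mathsf{p}^l,\mathsf{p}^p,\mathsf{p}^l_p,\mathsf{p}^p_l$ with their shifted counterparts $\mathsf{p}^l_m,\mathsf{p}^p_m,\mathsf{p}^l_{pm},\mathsf{p}^p_{lm}$, respectively, are concurrent.) Standing genericity: neighbouring lines $\mathsf{l}$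 and $\mathsf{l}_l$ are distinct, so that the points $\mathsf{p}^l$ are well defined. *)

theory Defs
  imports "HOL-Analysis.Analysis"
begin

type_synonym lattice = "int \<times> int \<times> int"

(* Unit shift in direction l for l = 1, 2, 3 (other values of l do not occur). *)
fun shift :: "nat \<Rightarrow> lattice \<Rightarrow> lattice" where
  "shift l (n1, n2, n3) =
     (n1 + of_bool (l = 1), n2 + of_bool (l = 2), n3 + of_bool (l = 3))"

(* Only the values M i k with i, k \<in> {1..5} are constrained or used. *)
definition M_system :: "(nat \<Rightarrow> nat \<Rightarrow> lattice \<Rightarrow> complex) \<Rightarrow> bool" where
  "M_system M \<longleftrightarrow>
     (\<forall>l\<in>{1,2,3}. \<forall>n. M l l n \<noteq> 0) \<and>
     (\<forall>i\<in>{1..5}. \<forall>k\<in>{1..5}. \<forall>l\<in>{1,2,3} - {i, k}. \<forall>n.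
        M i k (shift l n) = M i k n - M i l n * M l k n / M l l n)"

(* Leibniz expansion of the determinant of (M^{a_r b_s}) for multi-indices A, B given as
   lists of equal length.  It is spelled out because the size of the matrix is not a type. *)
definition minor ::
  "(nat \<Rightarrow> nat \<Rightarrow> lattice \<Rightarrow> complex) \<Rightarrow> nat list \<Rightarrow> nat list \<Rightarrow> lattice \<Rightarrow> complex" where
  "minor M A B n =
     (\<Sum>p | p permutes {..<length A}.
        of_int (sign p) * (\<Prod>r<length A. M (A ! r) (B ! p r) n))"

definition V :: "(nat \<Rightarrow> nat \<Rightarrow> lattice \<Rightarrow> complex) \<Rightarrow> lattice \<Rightarrow> complex ^ 6" where
  "V M n = vector [minor M [] [] n, minor M [4,5] [4,5] n, minor M [4] [4] n,
                   minor M [5] [5] n, minor M [5] [4] n, minor M [4] [5] n]"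

(* Points, lines and planes of CP^3 are the complex linear subspaces of C^4 of dimension
   1, 2 and 3; incidence is inclusion.  Homogeneous coordinates are indexed by 0, 1, 2, 3
   in the four-element type 4. *)
definition proj_point :: "(complex ^ 4) set \<Rightarrow> bool" where
  "proj_point P \<longleftrightarrow> vec.subspace P \<and> vec.dim P = 1"

definition proj_line :: "(complex ^ 4) set \<Rightarrow> bool" where
  "proj_line L \<longleftrightarrow> vec.subspace L \<and> vec.dim L = 2"

definition proj_plane :: "(complex ^ 4) set \<Rightarrow> bool" where
  "proj_plane E \<longleftrightarrow> vec.subspace E \<and> vec.dim E = 3"

definition coplanar4 ::
  "(complex ^ 4) set \<Rightarrow> (complex ^ 4) set \<Rightarrow> (complex ^ 4) set \<Rightarrow> (complex ^ 4) set \<Rightarrow> bool" where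
  "coplanar4 P Q R S \<longleftrightarrow>
     (\<exists>E. proj_plane E \<and> P \<subseteq> E \<and> Q \<subseteq> E \<and> R \<subseteq> E \<and> S \<subseteq> E)"

definition plucker_coord :: "complex ^ 4 \<Rightarrow> complex ^ 4 \<Rightarrow> 4 \<Rightarrow> 4 \<Rightarrow> complex" where
  "plucker_coord a b \<mu> \<nu> = a $ \<mu> * b $ \<nu> - a $ \<nu> * b $ \<mu>"

definition plucker_vector :: "complex ^ 4 \<Rightarrow> complex ^ 4 \<Rightarrow> complex ^ 6" where
  "plucker_vector a b =
     vector [plucker_coord a b 0 1, plucker_coord a b 2 3, plucker_coord a b 0 2,
             plucker_coord a b 1 3, plucker_coord a b 0 3, plucker_coord a b 1 2]"

(* The line L passes through the distinct points with homogeneous coordinates a and b, and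
   v is a representative of the projective vector of its Pluecker coordinates. *)
definition plucker_corresponds :: "(complex ^ 4) set \<Rightarrow> complex ^ 6 \<Rightarrow> bool" where
  "plucker_corresponds L v \<longleftrightarrow>
     (\<exists>a b c. a \<noteq> 0 \<and> b \<noteq> 0 \<and> vec.span {a} \<noteq> vec.span {b} \<and>
        L = vec.span {a, b} \<and> c \<noteq> 0 \<and> v = c *s plucker_vector a b)"

definition meet :: "(lattice \<Rightarrow> (complex ^ 4) set) \<Rightarrow> nat \<Rightarrow> lattice \<Rightarrow> (complex ^ 4) set" where
  "meet L l n = L n \<inter> L (shift l n)"

(* Neighbouring lines are required to intersect in exactly one point, so that all the points
   in the coplanarity condition are well defined; in particular neighbours are distinct. *)
definition fundamental_line_complex :: "(lattice \<Rightarrow> (complex ^ 4) set) \<Rightarrow> bool" where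
  "fundamental_line_complex L \<longleftrightarrow>
     (\<forall>n. proj_line (L n)) \<and>
     (\<forall>n. \<forall>l\<in>{1,2,3}. proj_point (meet L l n)) \<and>
     (\<forall>n. \<forall>l\<in>{1,2,3}. \<forall>m\<in>{1,2,3}. \<forall>p\<in>{1,2,3}.
        l \<noteq> m \<longrightarrow> l \<noteq> p \<longrightarrow> m \<noteq> p \<longrightarrow>
        coplanar4 (meet L l n) (meet L l (shift m n))
                  (meet L l (shift p (shift m n))) (meet L l (shift p n)))"

lemma minor_empty: "minor M [] [] n = 1"
  by (simp add: minor_def)

lemma minor_single: "minor M [i] [k] n = M i k n"
  by (simp add: minor_def lessThan_Suc)

lemma minor_pair:
  "minor M [i, j] [k, l] n = M i k n * M j l n - M i l n * M j k n"
proof -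
  have "{..<length [i, j]} = {0, 1}"
    by auto
  moreover have "{p. p permutes {0, 1::nat}} = {id, Transposition.transpose 0 1}"
    by (auto simp: permutes_doubleton_iff)
  moreover have "id \<noteq> Transposition.transpose 0 (1::nat)"
    by (metis id_apply transpose_apply_first zero_neq_one)
  ultimately show ?thesis
    by (simp add: minor_def sign_swap_id sign_id)
qed

lemma vector_6:
  "(vector [a, b, c, d, e, f] :: complex ^ 6) $ 1 = a"
  "(vector [a, b, c, d, e, f] :: complex ^ 6) $ 2 = b"
  "(vector [a, b, c, d, e, f] :: complex ^ 6) $ 3 = c"
  "(vector [a, b, c, d, e, f] :: complex ^ 6) $ 4 = d"
  "(vector [a, b, c, d, e, f] :: complex ^ 6) $ 5 = e"
  "(vector [a, b, c, d, e, f] :: complex ^ 6) $ 6 = f"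
  by (simp_all add: vector_def)

lemma exhaust_6: "x = 1 \<or> x = 2 \<or> x = 3 \<or> x = 4 \<or> x = 5 \<or> x = 6" for x :: 6
proof (induct x)
  case (of_int z)
  then have "0 \<le> z" and "z < 6" by simp_all
  then have "z = 0 \<or> z = 1 \<or> z = 2 \<or> z = 3 \<or> z = 4 \<or> z = 5" by arith
  then show ?case by auto
qed

lemma all_4_from_0: "(\<forall>x::4. P x) \<longleftrightarrow> P 0 \<and> P 1 \<and> P 2 \<and> P 3"
proof -
  have "(4::4) = 0" by simp
  then show ?thesis by (metis exhaust_4)
qed

(* The Pluecker correspondence assigns to V M n exactly one line. *)
lemma plucker_corresponds_V:
  "plucker_corresponds L (V M n) \<longleftrightarrow>
     L = {x. x $ 2 = M 4 4 n * x $ 1 - M 4 5 n * x $ 0 \<and>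
             x $ 3 = M 5 4 n * x $ 1 - M 5 5 n * x $ 0}" (is "_ \<longleftrightarrow> L = ?S")
proof -
  have span2: "x \<in> vec.span {a, b} \<longleftrightarrow> (\<exists>s t. x = s *s a + t *s b)" for x a b :: "complex ^ 4"
    by (auto simp: vec.span_insert vec.span_singleton algebra_simps)
  have V_comps: "V M n $ 1 = 1" "V M n $ 2 = M 4 4 n * M 5 5 n - M 4 5 n * M 5 4 n"
     "V M n $ 3 = M 4 4 n" "V M n $ 4 = M 5 5 n" "V M n $ 5 = M 5 4 n" "V M n $ 6 = M 4 5 n"
    by (simp_all only: V_def vector_6 minor_empty minor_single minor_pair)
  show ?thesis
  proof
    assume "plucker_corresponds L (V M n)"
    then obtain a b c where L: "L = vec.span {a, b}" and v: "V M n = c *s plucker_vector a b"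
      unfolding plucker_corresponds_def by blast
    have "V M n $ i = c * plucker_vector a b $ i" for i
      by (simp add: v)
    note eqs = this[of 1] this[of 3] this[of 4] this[of 5] this[of 6]
    have e: "c * (a$0 * b$1 - a$1 * b$0) = 1" "M 4 4 n = c * (a$0 * b$2 - a$2 * b$0)"
      "M 5 5 n = c * (a$1 * b$3 - a$3 * b$1)" "M 5 4 n = c * (a$0 * b$3 - a$3 * b$0)"
      "M 4 5 n = c * (a$1 * b$2 - a$2 * b$1)"
      using eqs unfolding V_comps plucker_vector_def vector_6 plucker_coord_def by simp_all
    show "L = ?S"
    proof (intro equalityI subsetI)
      fix x assume "x \<in> L"
      then obtain s t where x: "x = s *s a + t *s b" using L span2 by blast
      have "a$2 = M 4 4 n * a$1 - M 4 5 n * a$0" "b$2 = M 4 4 n * b$1 - M 4 5 n * b$0"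
        "a$3 = M 5 4 n * a$1 - M 5 5 n * a$0" "b$3 = M 5 4 n * b$1 - M 5 5 n * b$0"
        using e by algebra+
      then show "x \<in> ?S" by (simp add: x) (simp add: algebra_simps)
    next
      fix x assume x: "x \<in> ?S"
      define s t where "s = c * (x$0 * b$1 - x$1 * b$0)" and "t = c * (a$0 * x$1 - a$1 * x$0)"
      have "x$0 = s * a$0 + t * b$0" "x$1 = s * a$1 + t * b$1"
        using e(1) unfolding s_def t_def by algebra+
      moreover have "x$2 = s * a$2 + t * b$2" "x$3 = s * a$3 + t * b$3"
        using x by (simp_all add: e(2-5) s_def t_def algebra_simps)
      ultimately have "x = s *s a + t *s b" by (simp add: vec_eq_iff all_4_from_0)
      then show "x \<in> L" using L span2 by blast
    qed
  next
    assume L: "L = ?S"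
    define a :: "complex ^ 4" where
      "a = (\<chi> i. if i = 0 then 1 else if i = 1 then 0 else if i = 2 then - M 4 5 n else - M 5 5 n)"
    define b :: "complex ^ 4" where
      "b = (\<chi> i. if i = 0 then 0 else if i = 1 then 1 else if i = 2 then M 4 4 n else M 5 4 n)"
    have ab: "a$0 = 1" "a$1 = 0" "a$2 = - M 4 5 n" "a$3 = - M 5 5 n"
      "b$0 = 0" "b$1 = 1" "b$2 = M 4 4 n" "b$3 = M 5 4 n"
      by (simp_all add: a_def b_def)
    have "a \<noteq> 0" "b \<noteq> 0" using ab(1,6) by auto
    moreover have "a \<notin> vec.span {b}"
      using ab(1,5) by (auto simp: vec.span_singleton)
    then have "vec.span {a} \<noteq> vec.span {b}"
      by (metis insertI1 vec.span_base)
    moreover have "L = vec.span {a, b}"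
    proof (intro equalityI subsetI)
      fix x assume "x \<in> L"
      then have "x = x$0 *s a + x$1 *s b"
        by (simp add: L vec_eq_iff all_4_from_0 ab)
      then show "x \<in> vec.span {a, b}" using span2 by blast
    qed (auto simp: L span2 ab)
    moreover have "V M n = 1 *s plucker_vector a b"
    proof -
      have "V M n $ i = plucker_vector a b $ i" for i
        using exhaust_6[of i]
        by (elim disjE) (simp_all only: V_comps plucker_vector_def vector_6 plucker_coord_def ab,
            simp_all)
      then show ?thesis by (simp add: vec_eq_iff)
    qed
    ultimately show "plucker_corresponds L (V M n)"
      unfolding plucker_corresponds_def using zero_neq_one by metis
  qed
qed

end

theory Submission
  imports Defs
begin

text \<open>
  Since the first Pluecker coordinate is \<open>1\<close>, the line at \<open>n\<close> is the graph
  \<open>x2 = M44 x1 - M45 x0\<close>, \<open>x3 = M54 x1 - M55 x0\<close> of the \<open>2 \<times> 2\<close> block of \<open>M\<close> with indices \<open>4, 5\<close>.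
  A shift in direction \<open>l\<close> changes this block by the rank-one matrix
  \<open>(M4l, M5l)\<^sup>T (Ml4, Ml5) / Mll\<close>.  Hence neighbouring lines agree exactly over the solutions of
  \<open>Ml4 x1 = Ml5 x0\<close> as soon as they differ at all, and this gives one point of intersection
  (\<open>proj_point_meet\<close>).

  So the intersection point is cut out by three linear equations of the same shape, one for each of
  the rows \<open>4\<close>, \<open>5\<close>, \<open>l\<close> of \<open>M\<close>.  Fix \<open>m\<close> and \<open>p\<close> as the other two directions.  The three rows have
  a nontrivial combination \<open>r = \<alpha> M4 + \<beta> M5 + \<gamma> Ml\<close> whose entries in the columns \<open>m\<close> and \<open>p\<close>
  both vanish, because these are two equations for three unknowns.  The evolution subtracts from \<open>r\<close>
  multiples of these very entries, so the entries of \<open>r\<close> in the columns \<open>4\<close>, \<open>5\<close> are unchanged by the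
  shifts in the directions \<open>m\<close> and \<open>p\<close>.  The same combination of the three equations is
  \<open>\<alpha> x2 + \<beta> x3 = r4 x1 - r5 x0\<close>; it holds for all four points of the coplanarity
  condition and is the equation of a common plane (\<open>coplanar4_meet\<close>).  As \<open>r\<close> exists for all
  values of \<open>M\<close>, points that coincide or are collinear do not form a separate case.
\<close>

lemma dim_hyperplane_field:
  fixes t :: "'a::field ^ 'n"
  assumes "t \<noteq> 0"
  shows "vec.subspace {x. (\<Sum>i\<in>UNIV. t $ i * x $ i) = 0}" (is "vec.subspace ?H")
    and "vec.dim {x. (\<Sum>i\<in>UNIV. t $ i * x $ i) = 0} = CARD('n) - 1"
proof -
  define f :: "'a ^ 'n \<Rightarrow> 'a" where "f x = (\<Sum>i\<in>UNIV. t $ i * x $ i)" for x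
  have H: "?H = {x. f x = 0}" by (simp add: f_def)
  have add: "f (x + y) = f x + f y" for x y
    by (simp add: f_def algebra_simps sum.distrib)
  have scale: "f (c *s x) = c * f x" for c x
    by (simp add: f_def sum_distrib_left algebra_simps)
  have diff: "f (x - y) = f x - f y" for x y
    by (simp add: f_def algebra_simps sum_subtractf)
  have sub: "vec.subspace {x. f x = 0}"
    unfolding vec.subspace_def by (simp add: add scale) (simp add: f_def)
  then show "vec.subspace ?H" by (simp add: H)
  obtain j where j: "t $ j \<noteq> 0" using assms by (auto simp: vec_eq_iff)
  define e where "e = axis j (1::'a)"
  have fe: "f e \<noteq> 0"
    using j by (simp add: f_def e_def axis_def if_distrib[of "\<lambda>z. t $ _ * z"] cong: if_cong)
  have span: "vec.span {x. f x = 0} = {x. f x = 0}"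
    using sub by (simp add: vec.span_eq_iff)
  have "x \<in> vec.span (insert e {x. f x = 0})" for x
  proof -
    have "f (x - (f x / f e) *s e) = 0" using fe by (simp add: diff scale)
    then show ?thesis by (auto simp: vec.span_insert span)
  qed
  then have "vec.span (insert e {x. f x = 0}) = UNIV" by blast
  then have "vec.dim (insert e {x. f x = 0}) = CARD('n)"
    by (metis vec.dim_span vec_dim_card)
  moreover have "vec.dim (insert e {x. f x = 0}) = vec.dim {x. f x = 0} + 1"
    using fe by (simp add: vec.dim_insert span)
  ultimately show "vec.dim ?H = CARD('n) - 1" by (simp add: H)
qed

lemma proj_plane_equation:
  fixes \<alpha> \<beta> c d :: complex
  assumes "\<not> (\<alpha> = 0 \<and> \<beta> = 0 \<and> c = 0 \<and> d = 0)"
  shows "proj_plane {x :: complex ^ 4. \<alpha> * x $ 2 + \<beta> * x $ 3 = c * x $ 1 - d * x $ 0}"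
proof -
  define t :: "complex ^ 4" where
    "t = (\<chi> i. if i = 0 then d else if i = 1 then - c else if i = 2 then \<alpha> else \<beta>)"
  have t: "t $ 0 = d" "t $ 1 = - c" "t $ 2 = \<alpha>" "t $ 3 = \<beta>" by (simp_all add: t_def)
  have "t \<noteq> 0" using assms by (auto simp: vec_eq_iff all_4_from_0 t)
  have four: "(4::4) = 0" by simp
  have "{x. (\<Sum>i\<in>UNIV. t $ i * x $ i) = 0} = {x. \<alpha> * x $ 2 + \<beta> * x $ 3 = c * x $ 1 - d * x $ 0}"
    unfolding sum_4 four t by (auto simp: algebra_simps eq_neg_iff_add_eq_0)
  then show ?thesis
    using dim_hyperplane_field[OF \<open>t \<noteq> 0\<close>] by (simp add: proj_plane_def)
qed

lemma proj_line_plucker_corresponds: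
  assumes "plucker_corresponds L v"
  shows "proj_line L"
proof -
  obtain a b where ab: "a \<noteq> 0" "b \<noteq> 0" "vec.span {a} \<noteq> vec.span {b}" "L = vec.span {a, b}"
    using assms unfolding plucker_corresponds_def by blast
  have "a \<notin> vec.span {b}"
  proof
    assume "a \<in> vec.span {b}"
    then obtain k where k: "a = k *s b" by (auto simp: vec.span_singleton)
    then have "b = inverse k *s a" using ab(1) by auto
    then have "b \<in> vec.span {a}" by (auto simp: vec.span_singleton)
    with \<open>a \<in> vec.span {b}\<close> have "vec.span {a} = vec.span {b}"
      by (auto simp: vec.span_eq)
    with ab(3) show False by simp
  qed
  moreover have "vec.dim {b} = 1" using ab(2) by (simp add: vec.dim_insert)
  ultimately have "vec.dim {a, b} = 2" by (simp add: vec.dim_insert)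
  then show ?thesis by (simp add: proj_line_def ab(4))
qed

text \<open>
  The intersection of two distinct lines has dimension at most one, so a single nonzero common vector
  determines it.
\<close>

lemma proj_point_Int_lines:
  assumes "proj_line K" "proj_line L" "K \<noteq> L" "x \<in> K" "x \<in> L" "x \<noteq> 0"
  shows "proj_point (K \<inter> L)"
proof -
  have sub: "vec.subspace (K \<inter> L)"
    using assms by (simp add: proj_line_def vec.subspace_inter)
  have "vec.dim {x} \<le> vec.dim (K \<inter> L)"
    using assms by (intro vec.dim_subset) auto
  then have "1 \<le> vec.dim (K \<inter> L)" using assms(6) by (simp add: vec.dim_insert)
  moreover have "vec.dim (K \<inter> L) < 2"
  proof (rule ccontr)
    assume "\<not> vec.dim (K \<inter> L) < 2"
    then have "K \<inter> L = K" "K \<inter> L = L"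
      using vec.subspace_dim_equal[OF sub, of K] vec.subspace_dim_equal[OF sub, of L] assms(1,2)
      by (simp_all add: proj_line_def)
    with assms(3) show False by blast
  qed
  ultimately show ?thesis using sub by (simp add: proj_point_def)
qed

lemma nontrivial_relation_of_pairs:
  fixes x y z :: "'a::field \<times> 'a"
  shows "\<exists>a b c. \<not> (a = 0 \<and> b = 0 \<and> c = 0) \<and>
           a * fst x + b * fst y + c * fst z = 0 \<and> a * snd x + b * snd y + c * snd z = 0"
proof -
  let ?a = "fst y * snd z - snd y * fst z" and ?b = "fst z * snd x - snd z * fst x"
    and ?c = "fst x * snd y - snd x * fst y"
  \<comment> \<open>The cross product solves the system unless the two equations are linearly dependent.\<close>
  show ?thesis
  proof (cases "?a = 0 \<and> ?b = 0 \<and> ?c = 0")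
    case False
    have "?a * fst x + ?b * fst y + ?c * fst z = 0" "?a * snd x + ?b * snd y + ?c * snd z = 0"
      by algebra+
    with False show ?thesis by blast
  next
    case True
    show ?thesis
    proof (cases "x = 0")
      case True
      then show ?thesis by (intro exI[of _ 1] exI[of _ 0]) simp
    next
      case False
      then have "fst x \<noteq> 0 \<or> snd x \<noteq> 0" by (auto simp: prod_eq_iff)
      then show ?thesis
      proof
        assume "fst x \<noteq> 0"
        with True show ?thesis
          by (intro exI[of _ "- fst y"] exI[of _ "fst x"] exI[of _ 0]) (simp add: algebra_simps)
      next
        assume "snd x \<noteq> 0"
        with True show ?thesis
          by (intro exI[of _ "- snd y"] exI[of _ "snd x"] exI[of _ 0]) (simp add: algebra_simps)
      qed
    qed
  qed
qed

lemma M_system_shift: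
  assumes "M_system M" "i \<in> {1..5}" "k \<in> {1..5}" "l \<in> {1, 2, 3}" "l \<noteq> i" "l \<noteq> k"
  shows "M i k (shift l n) = M i k n - M i l n * M l k n / M l l n"
  using assms unfolding M_system_def by blast

locale plucker_lines =
  fixes M :: "nat \<Rightarrow> nat \<Rightarrow> lattice \<Rightarrow> complex"
    and L :: "lattice \<Rightarrow> (complex ^ 4) set"
  assumes M_system: "M_system M"
    and plucker: "\<And>n. plucker_corresponds (L n) (V M n)"
    and distinct: "\<And>n l. l \<in> {1, 2, 3} \<Longrightarrow> L (shift l n) \<noteq> L n"
begin

lemma L_eq:
  "L n = {x. x $ 2 = M 4 4 n * x $ 1 - M 4 5 n * x $ 0 \<and>
             x $ 3 = M 5 4 n * x $ 1 - M 5 5 n * x $ 0}"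
  using plucker plucker_corresponds_V by blast

lemma M_block_shift:
  assumes "l \<in> {1, 2, 3}" "i \<in> {4, 5}" "k \<in> {4, 5}"
  shows "M i k (shift l n) = M i k n - M i l n * M l k n / M l l n"
  using M_system by (rule M_system_shift) (use assms in auto)

text \<open>If a factor of the rank-one update of the block vanished, the line would not move.\<close>

lemma M_factors_nonzero:
  assumes "l \<in> {1, 2, 3}"
  shows "M 4 l n \<noteq> 0 \<or> M 5 l n \<noteq> 0" and "M l 4 n \<noteq> 0 \<or> M l 5 n \<noteq> 0"
  using distinct[OF assms, of n] unfolding L_eq by (auto simp: M_block_shift[OF assms])

lemma meet_eq:
  assumes l: "l \<in> {1, 2, 3}"
  shows "meet L l n = {x \<in> L n. M l 4 n * x $ 1 = M l 5 n * x $ 0}"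
proof -
  have nz: "M l l n \<noteq> 0" using M_system l unfolding M_system_def by blast
  have *: "M i 4 (shift l n) * x $ 1 - M i 5 (shift l n) * x $ 0 =
      M i 4 n * x $ 1 - M i 5 n * x $ 0
        - M i l n / M l l n * (M l 4 n * x $ 1 - M l 5 n * x $ 0)"
    if "i \<in> {4, 5}" for x :: "complex ^ 4" and i
    using that by (simp add: M_block_shift[OF l] algebra_simps diff_divide_distrib)
  show ?thesis
    using M_factors_nonzero(1)[OF l, of n] nz
    unfolding meet_def L_eq by (auto simp: *)
qed

lemma proj_point_meet:
  assumes l: "l \<in> {1, 2, 3}"
  shows "proj_point (meet L l n)"
proof -
  define x :: "complex ^ 4" where "x = (\<chi> i. if i = 0 then M l 4 n else if i = 1 then M l 5 n
    else if i = 2 then M 4 4 n * M l 5 n - M 4 5 n * M l 4 n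
    else M 5 4 n * M l 5 n - M 5 5 n * M l 4 n)"
  have x: "x $ 0 = M l 4 n" "x $ 1 = M l 5 n"
    "x $ 2 = M 4 4 n * M l 5 n - M 4 5 n * M l 4 n"
    "x $ 3 = M 5 4 n * M l 5 n - M 5 5 n * M l 4 n"
    by (simp_all add: x_def)
  have "x \<in> meet L l n" unfolding meet_eq[OF l] L_eq by (simp add: x)
  moreover have "x \<noteq> 0" using M_factors_nonzero(2)[OF l, of n] x by auto
  ultimately show ?thesis
    using distinct[OF l, of n] proj_line_plucker_corresponds[OF plucker]
    unfolding meet_def by (intro proj_point_Int_lines) auto
qed

text \<open>
  The equation of the plane is the combination, with coefficients \<open>\<alpha>\<close>, \<open>\<beta>\<close>, \<open>\<gamma>\<close>, of the two
  equations of the line and the equation \<open>M l 4 x1 = M l 5 x0\<close> of the intersection point on it.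
\<close>

lemma meet_subset_plane:
  assumes "l \<in> {1, 2, 3}"
    and c: "\<alpha> * M 4 4 n + \<beta> * M 5 4 n + \<gamma> * M l 4 n = c"
    and d: "\<alpha> * M 4 5 n + \<beta> * M 5 5 n + \<gamma> * M l 5 n = d"
  shows "meet L l n \<subseteq> {x. \<alpha> * x $ 2 + \<beta> * x $ 3 = c * x $ 1 - d * x $ 0}"
proof (clarsimp simp: meet_eq[OF assms(1)] L_eq)
  fix x :: "complex ^ 4"
  assume "M l 4 n * x $ 1 = M l 5 n * x $ 0"
  then show "\<alpha> * (M 4 4 n * x $ 1 - M 4 5 n * x $ 0) + \<beta> * (M 5 4 n * x $ 1 - M 5 5 n * x $ 0) =
      c * x $ 1 - d * x $ 0"
    unfolding c[symmetric] d[symmetric] by algebra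
qed

text \<open>
  The evolution acts on a combination of rows like on a single row: it subtracts a multiple of row
  \<open>m\<close>, the factor being the entry in column \<open>m\<close> over \<open>M m m\<close>.
\<close>

lemma row_combination_shift:
  assumes "m \<in> {1, 2, 3}" "l \<in> {1, 2, 3}" "m \<noteq> l" "k \<in> {1..5}" "m \<noteq> k"
    and "\<alpha> * M 4 m n + \<beta> * M 5 m n + \<gamma> * M l m n = 0"
  shows "\<alpha> * M 4 k (shift m n) + \<beta> * M 5 k (shift m n) + \<gamma> * M l k (shift m n) =
         \<alpha> * M 4 k n + \<beta> * M 5 k n + \<gamma> * M l k n"
proof -
  define q where "q = M m k n / M m m n"
  have row: "M i k (shift m n) = M i k n - M i m n * q" if "i \<in> {4, 5, l}" for i
  proof -
    have "i \<in> {1..5}" "m \<noteq> i" using that assms(1-3) by auto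
    then show ?thesis
      using M_system_shift[OF M_system _ assms(4) assms(1) _ assms(5)] by (simp add: q_def)
  qed
  have "\<alpha> * M 4 k (shift m n) + \<beta> * M 5 k (shift m n) + \<gamma> * M l k (shift m n) =
      \<alpha> * M 4 k n + \<beta> * M 5 k n + \<gamma> * M l k n
        - (\<alpha> * M 4 m n + \<beta> * M 5 m n + \<gamma> * M l m n) * q"
    by (simp add: row) (simp add: algebra_simps)
  then show ?thesis by (simp add: assms(6))
qed

lemma coplanar4_meet:
  assumes l: "l \<in> {1, 2, 3}" and m: "m \<in> {1, 2, 3}" and p: "p \<in> {1, 2, 3}"
    and "l \<noteq> m" "l \<noteq> p" "m \<noteq> p"
  shows "coplanar4 (meet L l n) (meet L l (shift m n))
                   (meet L l (shift p (shift m n))) (meet L l (shift p n))"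
proof -
  obtain \<alpha> \<beta> \<gamma> where nontrivial: "\<not> (\<alpha> = 0 \<and> \<beta> = 0 \<and> \<gamma> = 0)"
    and *: "\<alpha> * M 4 m n + \<beta> * M 5 m n + \<gamma> * M l m n = 0"
      "\<alpha> * M 4 p n + \<beta> * M 5 p n + \<gamma> * M l p n = 0"
    using nontrivial_relation_of_pairs[of "(M 4 m n, M 4 p n)" "(M 5 m n, M 5 p n)"
        "(M l m n, M l p n)"] by auto
  define r where "r k n' = \<alpha> * M 4 k n' + \<beta> * M 5 k n' + \<gamma> * M l k n'" for k n'
  have shift: "r k (shift j n') = r k n'"
    if "j \<in> {1, 2, 3}" "j \<noteq> l" "k \<in> {1..5}" "j \<noteq> k" "r j n' = 0" for j k n'
    using row_combination_shift[of j l k \<alpha> n' \<beta> \<gamma>] that l unfolding r_def by blast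
  have r0: "r m n = 0" "r p n = 0" using * by (simp_all add: r_def)
  \<comment> \<open>The entry in column \<open>p\<close> still vanishes after the shift by \<open>m\<close>, so the shift by \<open>p\<close> may follow.\<close>
  have "r p (shift m n) = 0" using shift[of m p n] m p assms(4-6) r0 by auto
  then have r: "r k (shift m n) = r k n" "r k (shift p n) = r k n"
    "r k (shift p (shift m n)) = r k n" if "k \<in> {4, 5}" for k
    using that m p assms(4-6) r0 shift[of m k n] shift[of p k n] shift[of p k "shift m n"] by auto
  let ?E = "{x :: complex ^ 4. \<alpha> * x $ 2 + \<beta> * x $ 3 = r 4 n * x $ 1 - r 5 n * x $ 0}"
  \<comment> \<open>For \<open>\<alpha> = \<beta> = 0\<close> the equation is a multiple of \<open>Ml4 x1 = Ml5 x0\<close>, which is not trivial.\<close>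
  have "\<not> (\<alpha> = 0 \<and> \<beta> = 0 \<and> r 4 n = 0 \<and> r 5 n = 0)"
    using nontrivial M_factors_nonzero(2)[OF l, of n] by (auto simp: r_def)
  then have "proj_plane ?E" by (rule proj_plane_equation)
  moreover have "meet L l n' \<subseteq> ?E" if "r 4 n' = r 4 n" "r 5 n' = r 5 n" for n'
    using meet_subset_plane[OF l that[unfolded r_def[of _ n']]] .
  ultimately show ?thesis
    unfolding coplanar4_def using r by (intro exI[of _ ?E]) auto
qed

end

theorem theorem4p4:
  fixes M :: "nat \<Rightarrow> nat \<Rightarrow> lattice \<Rightarrow> complex"
    and L :: "lattice \<Rightarrow> (complex ^ 4) set"
  assumes "M_system M"
    and "\<And>n. plucker_corresponds (L n) (V M n)"
    and "\<And>n l. l \<in> {1, 2, 3} \<Longrightarrow> L (shift l n) \<noteq> L n"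
  shows "fundamental_line_complex L"
proof -
  interpret plucker_lines M L using assms by unfold_locales
  show ?thesis
    unfolding fundamental_line_complex_def
    using proj_line_plucker_corresponds[OF plucker] proj_point_meet coplanar4_meet by blast
qed

end
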